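(* Let $k$ be a positive integer with $k \equiv 2 \pmod 4$ and let $x_0 := \frac{2k}{B_k}$. Then for all $n \in \mathbb{N}$, \[ \frac{\left(\frac{x_0 + \sqrt{\Delta_k}}{2}\right)^{n+1} - \left(\frac{x_0 - \sqrt{\Delta_k}}{2}\right)^{n+1}}{\sqrt{\Delta_k}} \leq \beta_k(n), \] where $\Delta_k = x_0^2 + 4(2^{k-1}+1)x_0$, and \[ \beta_k(n) \leq \frac{\left(x_0 - \frac{b_k - \sqrt{D_k}}{2}\right)\left(\frac{b_k + \sqrt{D_k}}{2}\right)^n + \left(\frac{b_k+\sqrt{D_k}}{2} - x_0\right)\left(\frac{b_k - \sqrt{D_k}}{2}\right)^n}{\sqrt{D_k}}, \] where $b_k = x_0 + a_k$, $c_k = (2^{k-1}+1 - a_k)x_0$, $D_k = b_k^2 + 4c_k$, with $a_2 = \sqrt{7/3}$ and $a_k = \frac{3^{k-1}+1}{2^{k-1}+1}$ for $k \geq 6$.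
   Context: For an even integer $k \geq 2$, $B_k$ denotes the $k$-th Bernoulli number (so e.g. $B_2 = 1/6$, $B_6 = 1/42$) and $\sigma_{\ell}(n) = \sum_{d \mid n} d^{\ell}$. Define the power series $\mathrm{E}_k(q) = 1 - \frac{2k}{B_k}\sum_{n=1}^{\infty} \sigma_{k-1}(n)\, q^n$ (for $k=2$ this is $1 - 24\sum_{n\ge1}\sigma_1(n)q^n$). The numbers $\beta_k(n)$ are the coefficients of the power series expansion $1/\mathrm{E}_k(q) = \sum_{n\ge 0}\beta_k(n) q^n$ around $q=0$. $\mathbb{N}$ denotes the positive integers. *)

theory Defs
  imports "HOL-Analysis.Analysis" "HOL-Computational_Algebra.Formal_Power_Series"
begin

definition bernoulli :: "nat \<Rightarrow> real" where
  "bernoulli k = fact k * fps_nth (fps_X / (fps_exp 1 - 1)) k"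

definition divisor_sigma :: "nat \<Rightarrow> nat \<Rightarrow> nat" where
  "divisor_sigma l n = (\<Sum>d | d dvd n. d ^ l)"

definition eisenstein :: "nat \<Rightarrow> real fps" where
  "eisenstein k = 1 - fps_const (2 * real k / bernoulli k) *
     Abs_fps (\<lambda>n. if n = 0 then 0 else real (divisor_sigma (k - 1) n))"

text \<open>The constant coefficient of \<^term>\<open>eisenstein k\<close> is 1, so its inverse in the ring of
  formal power series is also the Taylor series of the reciprocal around 0.\<close>

definition eisenstein_beta :: "nat \<Rightarrow> nat \<Rightarrow> real" where
  "eisenstein_beta k n = fps_nth (inverse (eisenstein k)) n"

end

theory Submission
  imports Defs
begin

unbundle no vec_syntax
unbundle fps_syntax

text \<open>
  Write \<open>l = k - 1\<close>. Since \<open>E\<^sub>k = 1 - x\<^sub>0 \<Sum> \<sigma>\<^sub>l(j) q\<^sup>j\<close>, the coefficients of the reciprocal satisfy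
  the renewal equation \<open>\<beta>(n) = x\<^sub>0 \<Sum> \<sigma>\<^sub>l(j) \<beta>(n - j)\<close>, and \<open>x\<^sub>0 > 0\<close> because \<open>k \<equiv> 2 (mod 4)\<close>.
  The solution of such an equation is monotone in the weights. The lower bound is the
  solution for the weights \<open>1, \<sigma>\<^sub>l(2), 0, 0, \<dots>\<close>; the upper bound is the solution for the
  weights \<open>1, \<sigma>\<^sub>l(2), a \<sigma>\<^sub>l(2), a\<^sup>2 \<sigma>\<^sub>l(2), \<dots>\<close>, so that it remains to show
  \<open>\<sigma>\<^sub>l(j) \<le> a\<^bsup>j-2\<^esup> \<sigma>\<^sub>l(2)\<close> for \<open>j \<ge> 2\<close>.
\<close>

section \<open>Signs of the Bernoulli numbers\<close>

text \<open>Adding \<open>X / 2\<close> removes the linear term, which turns the Riccati equation of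
  \<open>X / (exp X - 1)\<close> into a recursion without lower-order terms.\<close>

lemma bernoulli_fps_riccati:
  fixes G :: "real fps"
  assumes "G = fps_X / (fps_exp 1 - 1) + fps_const (1/2) * fps_X"
  shows "fps_X * fps_deriv G + G * G = G + fps_const (1/4) * fps_X ^ 2"
proof -
  define h where "h = (fps_exp 1 - 1 :: real fps)"
  define g where "g = fps_X / h"
  have h1: "h $ 1 \<noteq> 0" "h $ 0 = 0" by (auto simp: h_def)
  have "subdegree h = 1" using h1 by (intro subdegreeI) auto
  moreover have "h \<noteq> 0" using h1 by auto
  ultimately have "h dvd fps_X" by (subst fps_dvd_iff) auto
  then have gh: "g * h = fps_X" by (simp add: g_def)
  have "fps_deriv h = h + 1" by (simp add: h_def)
  with arg_cong[OF gh, of fps_deriv] have "g * (h + 1) + fps_deriv g * h = 1"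
    by simp
  \<comment> \<open>Multiplying once more by \<open>g\<close> makes \<open>g * h\<close> appear in
    every term that contains \<open>h\<close>; replacing it by \<open>fps_X\<close> eliminates the
    exponential.\<close>
  then have "g * (g * (h + 1) + fps_deriv g * h) = g" by simp
  then have e: "fps_X * fps_deriv g + fps_X * g + g * g = g"
    by (simp add: algebra_simps flip: gh)
  have G: "G = g + fps_const (1/2) * fps_X" by (simp add: assms g_def h_def)
  have c: "fps_const (1/2) * x + fps_const (1/2) * x = x" for x :: "real fps"
    by (simp flip: distrib_right)
  have c4: "fps_const (1/4) = fps_const (1/2) * (fps_const (1/2) :: real fps)" by simp
  have "fps_X * fps_deriv G + G * G = (fps_X * fps_deriv g
      + (fps_const (1/2) * (fps_X * g) + fps_const (1/2) * (fps_X * g)) + g * g)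
      + fps_const (1/2) * fps_X + fps_const (1/4) * fps_X ^ 2"
    unfolding c4 by (simp add: G algebra_simps power2_eq_square del: fps_const_mult)
  then show ?thesis unfolding c e by (simp add: G)
qed

text \<open>Sign bookkeeping for a convolution whose odd-indexed terms vanish: two even indices in
  the same class mod 4 have sum 0 mod 4, two in different classes have sum 2 mod 4. So the class of
  the sum alone decides whether the two coefficients have equal or opposite signs.\<close>

lemma mod_four_add_cases:
  fixes i j :: nat
  shows "odd i \<or> odd j \<or> i mod 4 = j mod 4 \<and> (i mod 4 = 0 \<or> i mod 4 = 2) \<and> (i + j) mod 4 = 0
    \<or> (i mod 4 = 0 \<and> j mod 4 = 2 \<or> i mod 4 = 2 \<and> j mod 4 = 0) \<and> (i + j) mod 4 = 2"
proof (cases "odd i \<or> odd j")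
  case False
  then have "even (i mod 4)" "even (j mod 4)" by (auto simp: dvd_mod_iff)
  moreover have "i mod 4 \<in> {0, 1, 2, 3}" "j mod 4 \<in> {0, 1, 2, 3}" by auto
  ultimately have "i mod 4 = 0 \<or> i mod 4 = 2" "j mod 4 = 0 \<or> j mod 4 = 2" by auto
  moreover have "(i + j) mod 4 = (i mod 4 + j mod 4) mod 4" by (simp add: mod_add_eq)
  ultimately show ?thesis by (elim disjE) simp_all
qed auto

text \<open>For \<open>n \<ge> 3\<close> the Riccati equation expresses
  \<open>(n + 1) * G $ n\<close> as minus the sum of \<open>G $ i * G $ (n - i)\<close> over
  \<open>0 < i < n\<close>. By strong induction every product vanishes if \<open>n\<close> is odd,
  and otherwise no two products have opposite signs.\<close>

lemma riccati_coeff_signs: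
  fixes G :: "real fps"
  assumes ric: "fps_X * fps_deriv G + G * G = G + fps_const (1/4) * fps_X ^ 2"
    and G0: "G $ 0 = 1"
  shows "(odd n \<longrightarrow> G $ n = 0) \<and> (n mod 4 = 2 \<longrightarrow> G $ n > 0)
    \<and> (n > 0 \<and> n mod 4 = 0 \<longrightarrow> G $ n < 0)"
proof (induction n rule: less_induct)
  case (less n)
  have co: "real n * G $ n + (\<Sum>i=0..n. G $ i * G $ (n - i)) = G $ n + (if n = 2 then 1/4 else 0)"
    for n
  proof -
    have "(fps_X * fps_deriv G) $ n = real n * G $ n" by (cases n) auto
    moreover have "(fps_const (1/4) * fps_X ^ 2 :: real fps) $ n = (if n = 2 then 1/4 else 0)"
      unfolding fps_mult_left_const_nth fps_X_power_nth by simp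
    ultimately show ?thesis
      using arg_cong[OF ric, of "\<lambda>f. f $ n"] by (simp add: fps_mult_nth[of G G])
  qed
  have 1: "G $ 1 = 0" using co[of 1] G0 by simp
  have G2: "G $ 2 > 0" using co[of 2] G0 1 by (simp add: numeral_2_eq_2)
  consider "n = 0" | "n = 1" | "n = 2" | "n \<ge> 3" by linarith
  then show ?case
  proof cases
    case 4
    let ?t = "\<lambda>i. G $ i * G $ (n - i)"
    \<comment> \<open>Since \<open>G $ 0 = 1\<close>, the end terms contribute
      \<open>2 * G $ n\<close>; together with \<open>n * G $ n\<close> on the left and
      \<open>G $ n\<close> on the right this yields the factor \<open>n + 1\<close>.\<close>
    have "{0..n} = insert 0 (insert n {1..<n})" using 4 by auto
    then have "(\<Sum>i=0..n. ?t i) = 2 * G $ n + (\<Sum>i\<in>{1..<n}. ?t i)" using 4 G0 by simp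
    with co[of n] 4 have rec: "(real n + 1) * G $ n = - (\<Sum>i\<in>{1..<n}. ?t i)"
      by (simp add: algebra_simps)
    have IH: "odd i \<Longrightarrow> G $ i = 0" "i mod 4 = 2 \<Longrightarrow> G $ i > 0" "i mod 4 = 0 \<Longrightarrow> G $ i < 0"
      if "i \<in> {1..<n}" for i using less.IH[of i] that by auto
    have mem: "n - i \<in> {1..<n}" if "i \<in> {1..<n}" for i using that by auto
    have n2: "2 + (n - 2) = n" using 4 by simp
    have two: "2 \<in> {1..<n}" using 4 by auto
    have od: "G $ n = 0" if "odd n"
    proof -
      have zero: "?t i = 0" if "i \<in> {1..<n}" for i
      proof -
        have "odd i \<or> odd (n - i)" using \<open>odd n\<close> that by auto
        then show ?thesis using IH(1)[OF that] IH(1)[OF mem[OF that]] by auto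
      qed
      have "(\<Sum>i\<in>{1..<n}. ?t i) = 0" by (intro sum.neutral ballI zero)
      then show ?thesis using rec by simp
    qed
    have po: "G $ n > 0" if n4: "n mod 4 = 2"
    proof -
      have le: "- ?t i \<ge> 0" if "i \<in> {1..<n}" for i
      proof -
        have "even n" using n4 by presburger
        then have "odd i \<or> i mod 4 = 0 \<and> (n - i) mod 4 = 2 \<or> i mod 4 = 2 \<and> (n - i) mod 4 = 0"
          using mod_four_add_cases[of i "n - i"] n4 that by auto
        then show ?thesis using IH[OF that] IH[OF mem[OF that]]
          by (auto simp: mult_le_0_iff less_imp_le)
      qed
      have "even n" using n4 by presburger
      then have "(n - 2) mod 4 = 0" using mod_four_add_cases[of 2 "n - 2", unfolded n2] n4 by auto
      then have "G $ (n - 2) < 0" by (rule IH(3)[OF mem[OF two]])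
      then have "- ?t 2 > 0" using G2 by (simp add: mult_less_0_iff)
      \<comment> \<open>The term at \<open>i = 2\<close> makes the inequality strict.\<close>
      then have "(\<Sum>i\<in>{1..<n}. - ?t i) > 0" using le two by (intro sum_pos2[of _ 2]) auto
      then have "(real n + 1) * G $ n > 0" using rec by (simp add: sum_negf)
      then show ?thesis by (simp add: zero_less_mult_iff)
    qed
    have ne: "G $ n < 0" if n4: "n mod 4 = 0"
    proof -
      have le: "?t i \<ge> 0" if "i \<in> {1..<n}" for i
      proof -
        have "even n" using n4 by presburger
        then have "odd i \<or> i mod 4 = 0 \<and> (n - i) mod 4 = 0 \<or> i mod 4 = 2 \<and> (n - i) mod 4 = 2"
          using mod_four_add_cases[of i "n - i"] n4 that by auto
        then show ?thesis using IH[OF that] IH[OF mem[OF that]]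
          by (auto simp: zero_le_mult_iff less_imp_le)
      qed
      have "even n" using n4 by presburger
      then have "(n - 2) mod 4 = 2" using mod_four_add_cases[of 2 "n - 2", unfolded n2] n4 by auto
      then have "G $ (n - 2) > 0" by (rule IH(2)[OF mem[OF two]])
      then have "?t 2 > 0" using G2 by (simp add: mult_less_0_iff)
      then have "(\<Sum>i\<in>{1..<n}. ?t i) > 0" using le two by (intro sum_pos2[of _ 2]) auto
      then have "(real n + 1) * G $ n < 0" using rec by simp
      then show ?thesis by (simp add: mult_less_0_iff)
    qed
    show ?thesis by (intro conjI impI) (use od po ne in auto)
  qed (use 1 G2 in auto)
qed

lemma bernoulli_pos:
  assumes "k mod 4 = 2"
  shows "bernoulli k > 0"
proof -
  define G :: "real fps" where "G = fps_X / (fps_exp 1 - 1) + fps_const (1/2) * fps_X"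
  have "G $ 0 = 1"
  proof -
    have "subdegree (fps_exp 1 - 1 :: real fps) = 1" by (intro subdegreeI) auto
    then have "(fps_X / (fps_exp 1 - 1) :: real fps) $ 0 = 1"
      by (simp add: fps_divide_def fps_shift_def)
    then show ?thesis by (simp add: G_def)
  qed
  from riccati_coeff_signs[OF bernoulli_fps_riccati[OF G_def] this, of k] assms
  have "G $ k > 0" by blast
  \<comment> \<open>The added \<open>X / 2\<close> changes only the coefficient of index 1.\<close>
  moreover have "k \<noteq> 1" using assms by auto
  ultimately have "(fps_X / (fps_exp 1 - 1) :: real fps) $ k > 0"
    by (cases "k = 0") (auto simp: G_def)
  then show ?thesis by (simp add: bernoulli_def)
qed

section \<open>Bounds for divisor sums\<close>

text \<open>A proper divisor of \<open>n\<close> is at most \<open>n div 2\<close>. The case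
  \<open>l = 1\<close> needs this saving: the sum over all \<open>d \<le> n\<close> already exceeds
  the geometric bound at \<open>n = 4\<close>.\<close>

lemma divisor_sigma_le:
  assumes "n > 0"
  shows "divisor_sigma l n \<le> n ^ l + (\<Sum>d=1..n div 2. d ^ l)"
proof -
  have "{d. d dvd n} \<subseteq> insert n {1..n div 2}"
  proof
    fix d assume "d \<in> {d. d dvd n}"
    then obtain e where e: "n = d * e" by auto
    with assms have "e = 1 \<or> e \<ge> 2" "d \<ge> 1" by (cases e; auto)+
    then show "d \<in> insert n {1..n div 2}"
    proof (elim disjE)
      assume "e \<ge> 2"
      then have "d * 2 \<le> n" using e by simp
      then show ?thesis using \<open>d \<ge> 1\<close> by auto
    qed (use e in auto)
  qed
  then have "divisor_sigma l n \<le> (\<Sum>d\<in>insert n {1..n div 2}. d ^ l)"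
    unfolding divisor_sigma_def by (intro sum_mono2) auto
  also have "\<dots> = n ^ l + (\<Sum>d=1..n div 2. d ^ l)" using assms by (subst sum.insert) auto
  finally show ?thesis .
qed

lemma divisor_sigma_le_power_sum:
  assumes "n > 0"
  shows "divisor_sigma l n \<le> (\<Sum>d=1..n. d ^ l)"
  unfolding divisor_sigma_def using assms by (intro sum_mono2) (auto dest: dvd_imp_le)

lemma divisor_sigma_1: "divisor_sigma l (Suc 0) = 1"
  by (simp add: divisor_sigma_def)

lemma divisor_sigma_prime:
  assumes "prime p"
  shows "divisor_sigma l p = p ^ l + 1"
proof -
  have "{d. d dvd p} = {1, p}" using assms by (auto simp: prime_nat_iff)
  moreover have "p \<noteq> 1" using assms by auto
  ultimately show ?thesis by (simp add: divisor_sigma_def)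
qed

text \<open>This is what remains of \<open>(2 ^ l + 1) * S 4 \<le> (3 ^ l + 1) ^ 2\<close> below
  after expanding and discarding a spare \<open>3 ^ l\<close>. In the induction step the right side
  grows by 9 and each term on the left by at most 8.\<close>

lemma nine_power_ge:
  assumes "l \<ge> 5"
  shows "(8::real) ^ l + 6 ^ l + 2 * 4 ^ l + 2 * 2 ^ l \<le> 9 ^ l"
  using assms
proof (induction l rule: dec_induct)
  case (step l)
  have "(0::real) \<le> 8 ^ l" "(0::real) \<le> 6 ^ l" "(0::real) \<le> 4 ^ l" "(0::real) \<le> 2 ^ l" by auto
  then show ?case using step.IH unfolding power_Suc by linarith
qed simp

text \<open>The ratio \<open>a\<close> is \<open>\<sigma>(3) / \<sigma>(2)\<close>, so equality
  holds at 2 and 3. From 4 on, the full power sum \<open>S n\<close> is bounded instead; it is too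
  large at 3, which is why the induction starts at 4.\<close>

lemma divisor_sigma_le_geometric:
  fixes a :: real
  assumes l: "l \<ge> 5" and a: "a = (3 ^ l + 1) / (2 ^ l + 1)" and n: "n \<ge> 2"
  shows "real (divisor_sigma l n) \<le> (2 ^ l + 1) * a ^ (n - 2)"
proof -
  define S where "S n = (\<Sum>d=1..n. real d ^ l)" for n
  have pos: "(2::real) ^ l + 1 > 0" by (simp add: add_pos_pos)
  have a0: "a > 0" unfolding a using pos by (simp add: add_pos_pos)
  have sq: "(2::real) ^ l * 2 ^ l = 4 ^ l" "(2::real) ^ l * 3 ^ l = 6 ^ l"
    "(2::real) ^ l * 4 ^ l = 8 ^ l" "(3::real) ^ l * 3 ^ l = 9 ^ l"
    by (simp_all flip: power_mult_distrib)
  have S4: "S 4 = 1 + 2 ^ l + 3 ^ l + 4 ^ l"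
    by (simp add: S_def numeral_eq_Suc)
  have base: "S 4 \<le> (2 ^ l + 1) * a ^ 2"
  proof -
    have "(2 ^ l + 1) * S 4 \<le> (3 ^ l + 1) ^ 2"
    proof -
      have "(2 ^ l + 1) * S 4 = 1 + 2 * 2 ^ l + 3 ^ l + 2 * 4 ^ l + 6 ^ l + 8 ^ l"
        unfolding S4 by (simp add: algebra_simps flip: sq)
      moreover have "((3::real) ^ l + 1) ^ 2 = 9 ^ l + 2 * 3 ^ l + 1"
        by (simp add: power2_eq_square algebra_simps flip: sq)
      moreover have "(3::real) ^ l \<ge> 0" by simp
      ultimately show ?thesis using nine_power_ge[OF l] by linarith
    qed
    moreover have "(2 ^ l + 1) * a ^ 2 = (3 ^ l + 1) ^ 2 / (2 ^ l + 1)"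
      using pos unfolding a power_divide by (simp add: power2_eq_square)
    ultimately show ?thesis using pos by (simp add: pos_le_divide_eq mult.commute)
  qed
  \<comment> \<open>For \<open>n \<ge> 3\<close> the new term satisfies
    \<open>(n + 1) ^ l \<le> (4/3) ^ l * n ^ l\<close>, so this bound makes \<open>S\<close> grow by
    a factor of at most \<open>a\<close> per step.\<close>
  have q: "(4/3) ^ l \<le> a - 1"
  proof -
    have "(4::real) ^ l * (2 ^ l + 1) \<le> 3 ^ l * (3 ^ l - 2 ^ l)"
    proof -
      have "(4::real) ^ l \<ge> 0" "(2::real) ^ l \<ge> 0" by simp_all
      then have "(8::real) ^ l + 4 ^ l + 6 ^ l \<le> 9 ^ l" using nine_power_ge[OF l] by linarith
      then show ?thesis by (simp add: algebra_simps sq)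
    qed
    then have "(4::real) ^ l / 3 ^ l \<le> (3 ^ l - 2 ^ l) / (2 ^ l + 1)"
      using pos by (simp add: divide_simps mult.commute)
    also have "(3 ^ l - 2 ^ l) / (2 ^ l + 1) = a - 1" using pos unfolding a by (simp add: field_simps)
    finally show ?thesis by (simp add: power_divide)
  qed
  have S: "S n \<le> (2 ^ l + 1) * a ^ (n - 2)" if "n \<ge> 4" for n
    using that
  proof (induction n rule: dec_induct)
    case (step n)
    have "real (Suc n) ^ l \<le> (4/3 * real n) ^ l" using step.hyps by (intro power_mono) auto
    also have "\<dots> = (4/3) ^ l * real n ^ l" by (rule power_mult_distrib)
    also have "\<dots> \<le> (a - 1) * S n"
    proof (intro mult_mono q)
      show "real n ^ l \<le> S n" unfolding S_def using step.hyps
        by (intro member_le_sum) auto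
      have "0 \<le> (4/3::real) ^ l" by simp
      then show "0 \<le> a - 1" using q by linarith
    qed auto
    finally have "S (Suc n) \<le> a * S n" by (simp add: S_def algebra_simps)
    also have "\<dots> \<le> a * ((2 ^ l + 1) * a ^ (n - 2))" using step.IH a0 by simp
    also have "\<dots> = (2 ^ l + 1) * a ^ Suc (n - 2)" by simp
    also have "Suc (n - 2) = Suc n - 2" using step.hyps by simp
    finally show ?case .
  qed (use base in simp)
  consider "n = 2" | "n = 3" | "n \<ge> 4" using n by linarith
  then show ?thesis
  proof cases
    case 1
    then show ?thesis by (simp add: divisor_sigma_prime)
  next
    case 2
    then show ?thesis using pos by (simp add: divisor_sigma_prime a)
  next
    case 3
    then have "divisor_sigma l n \<le> (\<Sum>d=1..n. d ^ l)" by (intro divisor_sigma_le_power_sum) auto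
    then have "real (divisor_sigma l n) \<le> real (\<Sum>d=1..n. d ^ l)" by (rule of_nat_mono)
    also have "\<dots> = S n" by (simp add: S_def)
    finally show ?thesis using S[OF 3] by linarith
  qed
qed

text \<open>The ratio \<open>\<sigma>(3) / \<sigma>(2) = 4/3\<close> is too small at
  \<open>n = 4\<close>; the base \<open>sqrt (7/3)\<close> gives equality there, as
  \<open>\<sigma>(4) = 7\<close>. Larger \<open>n\<close> are reduced to \<open>h = n div 2\<close>,
  where only the rational number \<open>a ^ 2 = 7/3\<close> occurs.\<close>

lemma divisor_sigma_one_le_geometric:
  assumes "n \<ge> 2"
  shows "real (divisor_sigma 1 n) \<le> 3 * sqrt (7/3) ^ (n - 2)"
proof -
  define a where "a = sqrt (7/3 :: real)"
  have a2: "a ^ 2 = 7/3" by (simp add: a_def)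
  have am: "a \<ge> 3/2" unfolding a_def by (intro real_le_rsqrt) (simp add: power2_eq_square)
  consider "n = 2" | "n = 3" | "n = 4" | "n = 5" | "n \<ge> 6" using assms by linarith
  then have "real (divisor_sigma 1 n) \<le> 3 * a ^ (n - 2)"
  proof cases
    case 1
    then show ?thesis by (simp add: divisor_sigma_prime)
  next
    case 2
    then show ?thesis using am by (simp add: divisor_sigma_prime)
  next
    case 3
    have "divisor_sigma 1 4 \<le> 7" using divisor_sigma_le[of 4 1]
      by (simp add: atLeastAtMost_upt upt_rec)
    then show ?thesis using a2 3 by simp
  next
    case 4
    have "divisor_sigma 1 5 = 6" using divisor_sigma_prime[of 5 1] by simp
    moreover have "a ^ 3 = 7/3 * a" using a2 by (simp add: power3_eq_cube power2_eq_square)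
    ultimately show ?thesis using am 4 by simp
  next
    case 5
    define h where "h = n div 2"
    have h: "h \<ge> 3" "n \<le> 2 * h + 1" "2 * h \<le> n" using 5 by (auto simp: h_def)
    have tri: "real (\<Sum>d=1..h. d) = real h * (real h + 1) / 2" for h
      by (induction h) (auto simp: field_simps)
    have "divisor_sigma 1 n \<le> n + (\<Sum>d=1..h. d)"
      using divisor_sigma_le[of n 1] 5 by (simp add: h_def)
    then have "real (divisor_sigma 1 n) \<le> real n + real (\<Sum>d=1..h. d)"
      by (metis of_nat_add of_nat_mono)
    also have "\<dots> \<le> 2 * real h + 1 + real h * (real h + 1) / 2"
      unfolding tri using h(2) by simp
    also have "\<dots> \<le> 3 * (7/3) ^ (h - 1)" using h(1)
    proof (induction h rule: dec_induct)
      case (step h)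
      have power: "(7/3::real) ^ (Suc h - 1) = 7/3 * (7/3) ^ (h - 1)"
        using step.hyps by (cases h) auto
      have "20 \<le> real h * 28 + real h * (real h * 8)"
        using step.hyps by (intro add_increasing2) auto
      then have "2 * (real h + 1) + 1 + (real h + 1) * (real h + 1 + 1) / 2
          \<le> 7/3 * (2 * real h + 1 + real h * (real h + 1) / 2)" by (simp add: field_simps)
      also have "\<dots> \<le> 7/3 * (3 * (7/3) ^ (h - 1))" using step.IH by (intro mult_left_mono) auto
      also have "\<dots> = 3 * (7/3) ^ (Suc h - 1)" unfolding power by simp
      finally show ?case by (simp add: add.commute)
    qed (simp add: power2_eq_square)
    also have "(7/3) ^ (h - 1) = a ^ (2 * h - 2)"
      by (simp add: a2[symmetric] right_diff_distrib' flip: power_mult)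
    also have "3 * a ^ (2 * h - 2) \<le> 3 * a ^ (n - 2)"
      using am h by (intro mult_left_mono power_increasing) auto
    finally show ?thesis .
  qed
  then show ?thesis by (simp add: a_def)
qed

section \<open>Renewal equations\<close>

text \<open>Nonnegativity of \<open>u\<close> is proved along with the comparison, since multiplying
  the inequalities for weights and values requires it.\<close>

lemma renewal_mono:
  fixes u v s t :: "nat \<Rightarrow> real"
  assumes u0: "u 0 = 1" and v0: "v 0 = 1" and x: "x \<ge> 0"
    and u: "\<And>n. n > 0 \<Longrightarrow> u n = x * (\<Sum>j=1..n. s j * u (n - j))"
    and v: "\<And>n. n > 0 \<Longrightarrow> v n = x * (\<Sum>j=1..n. t j * v (n - j))"
    and st: "\<And>j. j > 0 \<Longrightarrow> 0 \<le> s j \<and> s j \<le> t j"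
  shows "0 \<le> u n \<and> u n \<le> v n"
proof (induction n rule: less_induct)
  case (less n)
  show ?case
  proof (cases "n = 0")
    case False
    have IH: "0 \<le> u (n - j)" "u (n - j) \<le> v (n - j)" if "j \<in> {1..n}" for j
      using less.IH[of "n - j"] that by auto
    have "(\<Sum>j=1..n. s j * u (n - j)) \<le> (\<Sum>j=1..n. t j * v (n - j))"
      using IH st order_trans[OF conjunct1[OF st] conjunct2[OF st]]
      by (intro sum_mono mult_mono) auto
    moreover have "0 \<le> (\<Sum>j=1..n. s j * u (n - j))" using IH st by (intro sum_nonneg) auto
    ultimately show ?thesis using False x u v by (simp add: mult_left_mono)
  qed (use u0 v0 in simp)
qed

text \<open>Since \<open>0 ^ 0 = 1\<close>, the case \<open>a = 0\<close> covers the weights \<open>1, s, 0, 0, \<dots>\<close> of the lower bound.\<close>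

lemma renewal_geometric_weights:
  fixes w :: "nat \<Rightarrow> real"
  assumes w0: "w 0 = 1" and w1: "w 1 = x"
    and w: "\<And>n. w (n + 2) = (x + a) * w (n + 1) + (s - a) * x * w n"
    and n: "n > 0"
  shows "w n = x * (\<Sum>j=1..n. (if j = 1 then 1 else s * a ^ (j - 2)) * w (n - j))"
proof -
  let ?t = "\<lambda>j. if j = 1 then 1 else s * a ^ (j - 2)"
  define F where "F n = (\<Sum>j=1..n. ?t j * w (n - j))" for n
  \<comment> \<open>From index 2 on the weights are geometric, so a shift by one multiplies them by
    \<open>a\<close> and the tail of \<open>F (m + 2)\<close> is \<open>a\<close> times that of
    \<open>F (m + 1)\<close>. The \<open>j = 1\<close> term \<open>w m\<close> is outside that tail,
    whence \<open>s - a\<close>.\<close>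
  have F: "F (m + 2) = a * F (m + 1) + w (m + 1) + (s - a) * w m" for m
  proof -
    have "F (m + 2) = w (m + 1) + s * w m + (\<Sum>j=3..m+2. ?t j * w (m + 2 - j))"
    proof -
      have "{1..m+2} = insert 1 (insert 2 {3..m+2})" by auto
      then show ?thesis by (simp add: F_def)
    qed
    also have "(\<Sum>j=3..m+2. ?t j * w (m + 2 - j)) = (\<Sum>j=2..m+1. ?t (j + 1) * w (m + 1 - j))"
      by (rule sum.reindex_bij_witness[of _ "\<lambda>j. j + 1" "\<lambda>j. j - 1"]) auto
    also have "\<dots> = a * (\<Sum>j=2..m+1. ?t j * w (m + 1 - j))"
      unfolding sum_distrib_left
    proof (intro sum.cong refl)
      fix j assume "j \<in> {2..m+1}"
      then obtain i where "j = i + 2" by (metis atLeastAtMost_iff le_Suc_ex add.commute)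
      then show "?t (j + 1) * w (m + 1 - j) = a * (?t j * w (m + 1 - j))" by simp
    qed
    also have "(\<Sum>j=2..m+1. ?t j * w (m + 1 - j)) = F (m + 1) - w m"
      unfolding F_def by (simp add: sum.atLeast_Suc_atMost numeral_eq_Suc)
    finally show ?thesis by (simp add: algebra_simps)
  qed
  \<comment> \<open>The recurrences for \<open>w\<close> and \<open>x * F\<close> differ only in
    having \<open>a * w (m + 1)\<close> versus \<open>a * x * F (m + 1)\<close>, so one-step
    induction suffices.\<close>
  have "w (Suc m) = x * F (Suc m)" for m
  proof (induction m)
    case 0
    then show ?case using w0 w1 by (simp add: F_def)
  next
    case (Suc m)
    have "w (m + 2) = x * F (m + 2)" unfolding F w using Suc.IH by (simp add: algebra_simps)
    then show ?case by simp
  qed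
  from this[of "n - 1"] n show ?thesis by (simp add: F_def)
qed

text \<open>The two bases are the roots of \<open>r\<^sup>2 = p * r + q\<close>.\<close>

lemma second_order_recurrence_roots:
  fixes p q :: real
  assumes D: "D = p\<^sup>2 + 4 * q" "D > 0"
    and w: "\<And>n. w n = A * ((p + sqrt D) / 2) ^ n + B * ((p - sqrt D) / 2) ^ n"
  shows "w (n + 2) = p * w (n + 1) + q * w n"
proof -
  have sD: "sqrt D * sqrt D = p\<^sup>2 + 4 * q" using D by simp
  have r: "((p + sqrt D) / 2)\<^sup>2 = p * ((p + sqrt D) / 2) + q"
    "((p - sqrt D) / 2)\<^sup>2 = p * ((p - sqrt D) / 2) + q"
    using sD by (simp_all add: power2_eq_square field_simps)
  show ?thesis unfolding w power_add r by (simp add: algebra_simps)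
qed

section \<open>Coefficients of the reciprocal Eisenstein series and their comparison with the
  bounds\<close>

lemma eisenstein_beta_0: "eisenstein_beta k 0 = 1"
  by (simp add: eisenstein_beta_def eisenstein_def)

lemma eisenstein_beta_renewal:
  assumes "n > 0"
  shows "eisenstein_beta k n = 2 * real k / bernoulli k *
    (\<Sum>j=1..n. real (divisor_sigma (k - 1) j) * eisenstein_beta k (n - j))"
proof -
  define x where "x = 2 * real k / bernoulli k"
  define \<sigma> where "\<sigma> j = real (divisor_sigma (k - 1) j)" for j
  have E0: "eisenstein k $ 0 = 1" by (simp add: eisenstein_def)
  have Ej: "eisenstein k $ j = - x * \<sigma> j" if "j > 0" for j
    using that by (simp add: eisenstein_def x_def \<sigma>_def)
  have "(eisenstein k * inverse (eisenstein k)) $ n = 0"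
    using E0 assms by (subst inverse_mult_eq_1') auto
  then have "0 = (\<Sum>j=0..n. eisenstein k $ j * eisenstein_beta k (n - j))"
    by (simp add: fps_mult_nth eisenstein_beta_def)
  also have "\<dots> = eisenstein_beta k n + (\<Sum>j=1..n. eisenstein k $ j * eisenstein_beta k (n - j))"
    by (simp add: sum.atLeast_Suc_atMost E0)
  also have "(\<Sum>j=1..n. eisenstein k $ j * eisenstein_beta k (n - j))
      = - x * (\<Sum>j=1..n. \<sigma> j * eisenstein_beta k (n - j))"
    unfolding sum_distrib_left by (intro sum.cong) (auto simp: Ej)
  finally show ?thesis by (simp add: x_def \<sigma>_def)
qed

theorem theorem2:
  fixes k n :: nat and x0 \<Delta> a b c D :: real
  assumes "k > 0" and "k mod 4 = 2" and "n > 0"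
    and "x0 = 2 * real k / bernoulli k"
    and "\<Delta> = x0\<^sup>2 + 4 * (2 ^ (k - 1) + 1) * x0"
    and "a = (if k = 2 then sqrt (7 / 3) else (3 ^ (k - 1) + 1) / (2 ^ (k - 1) + 1))"
    and "b = x0 + a"
    and "c = (2 ^ (k - 1) + 1 - a) * x0"
    and "D = b\<^sup>2 + 4 * c"
  shows "(((x0 + sqrt \<Delta>) / 2) ^ (n + 1) - ((x0 - sqrt \<Delta>) / 2) ^ (n + 1)) / sqrt \<Delta>
           \<le> eisenstein_beta k n
       \<and> eisenstein_beta k n
           \<le> ((x0 - (b - sqrt D) / 2) * ((b + sqrt D) / 2) ^ n
              + ((b + sqrt D) / 2 - x0) * ((b - sqrt D) / 2) ^ n) / sqrt D"
proof -
  define s where "s = (2::real) ^ (k - 1) + 1"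
  define \<sigma> where "\<sigma> j = real (divisor_sigma (k - 1) j)" for j
  define L where "L n = (((x0 + sqrt \<Delta>) / 2) ^ (n + 1) - ((x0 - sqrt \<Delta>) / 2) ^ (n + 1)) / sqrt \<Delta>"
    for n
  define U where "U n = ((x0 - (b - sqrt D) / 2) * ((b + sqrt D) / 2) ^ n
              + ((b + sqrt D) / 2 - x0) * ((b - sqrt D) / 2) ^ n) / sqrt D" for n
  have x0: "x0 > 0" using assms(1,4) bernoulli_pos[OF assms(2)] by simp
  have s1: "s \<ge> 1" by (simp add: s_def)
  \<comment> \<open>The congruence leaves no \<open>k\<close> strictly between 2 and 6.\<close>
  have k: "k = 2 \<or> k - 1 \<ge> 5" using assms(1,2) by presburger
  have \<sigma>_le: "\<sigma> j \<le> s * a ^ (j - 2)" if "j \<ge> 2" for j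
  proof (cases "k = 2")
    case True
    then show ?thesis using divisor_sigma_one_le_geometric[OF that] assms(6)
      by (simp add: \<sigma>_def s_def)
  next
    case False
    then show ?thesis using divisor_sigma_le_geometric[OF _ _ that, of "k - 1" a] k assms(6)
      by (simp add: \<sigma>_def s_def)
  qed
  \<comment> \<open>Both weight sequences agree with \<open>\<sigma>\<close> at 1 and 2.\<close>
  have \<sigma>12: "\<sigma> 1 = 1" "\<sigma> 2 = s" by (simp_all add: \<sigma>_def s_def divisor_sigma_1 divisor_sigma_prime)
  \<comment> \<open>The second inequality gives \<open>c > 0\<close>, hence \<open>D > 0\<close>, so
    that division by \<open>sqrt D\<close> is legitimate.\<close>
  have a: "a > 0" "a < s"
  proof -
    show "a > 0" using assms(6) by (auto simp: add_pos_pos)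
    show "a < s"
    proof (cases "k = 2")
      case True
      have "sqrt (7/3) < sqrt (3 ^ 2)" by (intro real_sqrt_less_mono) simp
      then show ?thesis using True assms(6) by (simp add: s_def)
    next
      case False
      have "(3::real) ^ (k - 1) \<le> 4 ^ (k - 1)" by (intro power_mono) auto
      also have "\<dots> = 2 ^ (k - 1) * 2 ^ (k - 1)" by (simp flip: power_mult_distrib)
      finally have "3 ^ (k - 1) \<le> (2::real) ^ (k - 1) * 2 ^ (k - 1)" .
      moreover have "(2::real) ^ (k - 1) > 0" by simp
      ultimately have "3 ^ (k - 1) + 1 < s * s" unfolding s_def distrib_left distrib_right by linarith
      then show ?thesis using False assms(6) s1 by (auto simp: s_def pos_divide_less_eq add_pos_pos)
    qed
  qed
  have \<Delta>: "\<Delta> = x0\<^sup>2 + 4 * (s * x0)" using assms(5) by (simp add: s_def)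
  have \<Delta>0: "\<Delta> > 0" unfolding \<Delta> using x0 s1 by (simp add: add_pos_pos)
  have c: "c = (s - a) * x0" using assms(8) by (simp add: s_def)
  then have "c > 0" using a x0 by simp
  then have D0: "D > 0" unfolding assms(9) by (simp add: add_nonneg_pos)
  define r where "r = sqrt \<Delta>"
  have r: "r > 0" using \<Delta>0 by (simp add: r_def)
  define d where "d = sqrt D"
  have d: "d > 0" using D0 by (simp add: d_def)
  have L01: "L 0 = 1" "L 1 = x0"
    using r unfolding L_def r_def[symmetric] by (simp_all add: field_simps power2_eq_square)
  \<comment> \<open>The extra factor from the exponent \<open>m + 1\<close> is absorbed into the
    constants \<open>A\<close> and \<open>B\<close> of the two-root form.\<close>
  have "(P ^ (m + 1) - Q ^ (m + 1)) / r = P / r * P ^ m + - Q / r * Q ^ m" for P Q m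
    by (simp add: diff_divide_distrib)
  then have "L m = (x0 + sqrt \<Delta>) / 2 / r * ((x0 + sqrt \<Delta>) / 2) ^ m
      + - ((x0 - sqrt \<Delta>) / 2) / r * ((x0 - sqrt \<Delta>) / 2) ^ m" for m
    unfolding L_def r_def .
  from second_order_recurrence_roots[OF \<Delta> \<Delta>0 this]
  have "L (m + 2) = x0 * L (m + 1) + s * x0 * L m" for m .
  \<comment> \<open>Written with \<open>a = 0\<close> to match the recurrence for geometric
    weights.\<close>
  then have L2: "L (m + 2) = (x0 + 0) * L (m + 1) + (s - 0) * x0 * L m" for m by simp
  have U01: "U 0 = 1" "U 1 = x0"
    using d unfolding U_def d_def[symmetric] by (simp_all add: field_simps)
  have "(A * P + B * Q) / d = A / d * P + B / d * Q" for A B P Q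
    by (simp add: add_divide_distrib)
  then have "U m = (x0 - (b - sqrt D) / 2) / d * ((b + sqrt D) / 2) ^ m
      + ((b + sqrt D) / 2 - x0) / d * ((b - sqrt D) / 2) ^ m" for m
    unfolding U_def d_def .
  from second_order_recurrence_roots[OF assms(9) D0 this]
  have "U (m + 2) = b * U (m + 1) + c * U m" for m .
  then have U2: "U (m + 2) = (x0 + a) * U (m + 1) + (s - a) * x0 * U m" for m
    by (simp add: assms(7) c)
  have beta: "eisenstein_beta k n = x0 * (\<Sum>j=1..n. \<sigma> j * eisenstein_beta k (n - j))"
    if "n > 0" for n
    using eisenstein_beta_renewal[OF that, of k] assms(4) by (simp add: \<sigma>_def)
  note Lr = renewal_geometric_weights[of L, OF L01 L2]
  note Ur = renewal_geometric_weights[of U, OF U01 U2]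
  have "L n \<le> eisenstein_beta k n"
  proof (rule conjunct2[OF renewal_mono[OF L01(1) eisenstein_beta_0 less_imp_le[OF x0] Lr beta]])
    fix j :: nat assume "j > 0"
    then consider "j = 1" | "j = 2" | "j > 2" by linarith
    then show "0 \<le> (if j = 1 then 1 else s * 0 ^ (j - 2)) \<and> (if j = 1 then 1 else s * 0 ^ (j - 2)) \<le> \<sigma> j"
    proof cases
      case 3
      then show ?thesis by (simp add: \<sigma>_def power_0_left)
    qed (use \<sigma>12 s1 in auto)
  qed
  moreover have "eisenstein_beta k n \<le> U n"
  proof (rule conjunct2[OF renewal_mono[OF eisenstein_beta_0 U01(1) less_imp_le[OF x0] beta Ur]])
    fix j :: nat assume "j > 0"
    then consider "j = 1" | "j \<ge> 2" by linarith
    then show "0 \<le> \<sigma> j \<and> \<sigma> j \<le> (if j = 1 then 1 else s * a ^ (j - 2))"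
      using \<sigma>12(1) \<sigma>_le[of j] by cases (auto simp: \<sigma>_def)
  qed
  ultimately show ?thesis by (simp add: L_def U_def)
qed

end
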